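(* Let $n_3\geq n_1\geq n_2\geq 0$ be integers. Then $$ \begin{aligned} L_q\big(C_{n_1}(x,a;q)\,C_{n_2}(x,a;q)\,C_{n_3}(x,a;q)\big)= \sum_{l=0}^{n_1+n_2-n_3}\sum_{j=0}^{l} & a^{n_3+l}\, q^{K}(q-1)^{l-j}\,\frac{[n_1-j]!_q}{[n_1-l]!_q}\begin{bmatrix} n_2\\ l-j\end{bmatrix}_q [n_3]!_q\begin{bmatrix} n_1\\ j\end{bmatrix}_q\\ &\times \begin{bmatrix} n_2-l+j\\ n_3-n_1+j\end{bmatrix}_q \frac{[j]!_q\,[n_1-j]!_q}{[n_3-n_2+l]!_q} \begin{bmatrix} n_1+n_2-n_3-l\\ j\end{bmatrix}_q, \end{aligned} $$ where $$ K=\binom{l-j}{2}+\binom{n_1}{2}+j(-n_3-j+1)+\binom{j}{2}+\binom{n_2-l+j}{2}+(n_3-n_1+j)(n_3-n_2+l)+j(n_3-n_2+l). $$ (The sum is empty, hence $0$, if $n_1+n_2<n_3$.)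
   Context: Let $a,q$ be indeterminates. Write $[n]_q=\frac{1-q^n}{1-q}$, $[n]!_q=[n]_q[n-1]_q\cdots[1]_q$ (with $[0]!_q=1$), and $\begin{bmatrix} n\\k\end{bmatrix}_q=\frac{[n]!_q}{[k]!_q[n-k]!_q}$ for $0\le k\le n$, and $0$ if $k<0$ or $k>n$. The $q$-Charlier polynomials $C_n(x,a;q)$ are the monic polynomials in $x$ defined by $C_{-1}(x,a;q)=0$, $C_0(x,a;q)=1$ and $$C_{n+1}(x,a;q)=(x-aq^n-[n]_q)\,C_n(x,a;q)-a[n]_q q^{n-1}C_{n-1}(x,a;q)\qquad(n\ge 0).$$ $L_q$ denotes the linear functional on polynomials in $x$ (over $\mathbb{Q}(a,q)$) with respect to which these polynomials are orthogonal, normalized by $L_q(1)=1$; equivalently, $L_q$ is the unique linear functional with $L_q(1)=1$ and $L_q(C_n(x,a;q))=0$ for all $n\ge 1$. *)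

theory Defs
  imports "HOL-Computational_Algebra.Computational_Algebra"
begin

text \<open>
  The definitions take the parameters \<open>a\<close> and \<open>q\<close> in an arbitrary field. At \<open>q = 1\<close> the \<open>q\<close>-integer
  is \<open>0\<close>, not \<open>n\<close>, because of division by zero; \<open>q\<close> is only used as an indeterminate below.
\<close>

definition q_int :: "'k::field \<Rightarrow> nat \<Rightarrow> 'k" where
  "q_int q n = (1 - q ^ n) / (1 - q)"

definition q_fact :: "'k::field \<Rightarrow> nat \<Rightarrow> 'k" where
  "q_fact q n = (\<Prod>i=1..n. q_int q i)"

definition q_binomial :: "'k::field \<Rightarrow> nat \<Rightarrow> nat \<Rightarrow> 'k" where
  "q_binomial q n k = (if k \<le> n then q_fact q n / (q_fact q k * q_fact q (n - k)) else 0)"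

text \<open>
  Polynomials in \<open>x\<close>. With \<open>C\<^sub>-\<^sub>1 = 0\<close> and \<open>[0] = 0\<close>, the three-term recurrence at \<open>n = 0\<close>
  is \<open>C\<^sub>1 = (x - a q\<^sup>0 - [0]) C\<^sub>0\<close>; the third equation is the recurrence at \<open>Suc n\<close>.
\<close>

fun q_charlier :: "'k::field \<Rightarrow> 'k \<Rightarrow> nat \<Rightarrow> 'k poly" where
  "q_charlier a q 0 = 1"
| "q_charlier a q (Suc 0) = [:0, 1:] - [:a * q ^ 0 + q_int q 0:]"
| "q_charlier a q (Suc (Suc n)) =
     ([:0, 1:] - [:a * q ^ Suc n + q_int q (Suc n):]) * q_charlier a q (Suc n)
     - smult (a * q_int q (Suc n) * q ^ n) (q_charlier a q n)"

definition is_q_charlier_functional :: "'k::field \<Rightarrow> 'k \<Rightarrow> ('k poly \<Rightarrow> 'k) \<Rightarrow> bool" where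
  "is_q_charlier_functional a q L \<longleftrightarrow>
     Vector_Spaces.linear smult (*) L \<and>
     (\<forall>m n. m \<noteq> n \<longrightarrow> L (q_charlier a q m * q_charlier a q n) = 0) \<and>
     L 1 = 1"

text \<open>Existence and uniqueness are shown in \<open>q_charlier_functional_ex1\<close> below.\<close>

definition q_charlier_functional :: "'k::field \<Rightarrow> 'k \<Rightarrow> 'k poly \<Rightarrow> 'k" where
  "q_charlier_functional a q = (THE L. is_q_charlier_functional a q L)"

text \<open>
  The field \<open>\<rat>(a, q)\<close>, realised as the fraction field of \<open>\<rat>[a][q]\<close>, and its two generators.
\<close>

type_synonym rat_fun_aq = "rat poly poly fract"

definition indet_a :: rat_fun_aq where
  "indet_a = Fract [:[:0, 1:]:] 1"

definition indet_q :: rat_fun_aq where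
  "indet_q = Fract [:0, 1:] 1"


subsection \<open>The functional is well defined\<close>

lemma degree_q_charlier_monic:
  "degree (q_charlier a q n) = n \<and> coeff (q_charlier a q n) n = 1"
proof (induction a q n rule: q_charlier.induct)
  case (3 a q n)
  let ?C = "q_charlier a q"
  let ?f = "[:0, 1:] - [:a * q ^ Suc n + q_int q (Suc n):]"
  let ?r = "smult (a * q_int q (Suc n) * q ^ n) (?C n)"
  have f: "?f = [:- (a * q ^ Suc n + q_int q (Suc n)), 1:]" by simp
  have nz: "?C (Suc n) \<noteq> 0" using 3 by fastforce
  have df: "degree ?f = 1" "?f \<noteq> 0" unfolding f by auto
  have d: "degree (?f * ?C (Suc n)) = Suc (Suc n)"
    using degree_mult_eq[OF df(2) nz] df(1) 3 by simp
  have r: "degree ?r < Suc (Suc n)"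
    using 3 degree_smult_le[of "a * q_int q (Suc n) * q ^ n" "?C n"] by linarith
  have "lead_coeff (?f * ?C (Suc n)) = 1"
    unfolding lead_coeff_mult using 3 by (simp add: f)
  then have c: "coeff (?f * ?C (Suc n)) (Suc (Suc n)) = 1" using d by simp
  have "degree (?f * ?C (Suc n) - ?r) = Suc (Suc n)"
    using degree_add_eq_left[of "- ?r" "?f * ?C (Suc n)"] d r by simp
  moreover have "coeff (?f * ?C (Suc n) - ?r) (Suc (Suc n)) = 1"
    using c coeff_eq_0[OF r] by simp
  ultimately show ?case by simp
qed (simp_all add: q_int_def)

text \<open>The \<open>n\<close>-th moment of the functional, forced by \<open>L (C\<^sub>n) = 0\<close> for \<open>n \<ge> 1\<close>.\<close>

fun q_charlier_moment :: "'k::field \<Rightarrow> 'k \<Rightarrow> nat \<Rightarrow> 'k" where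
  "q_charlier_moment a q n =
     (if n = 0 then 1 else - (\<Sum>i<n. coeff (q_charlier a q n) i * q_charlier_moment a q i))"

declare q_charlier_moment.simps [simp del]

lemma linear_functional_eqI:
  fixes L M :: "'k::field poly \<Rightarrow> 'k"
  assumes L: "Vector_Spaces.linear smult (*) L" and M: "Vector_Spaces.linear smult (*) M"
    and eq: "\<And>n. L (q_charlier a q n) = M (q_charlier a q n)"
  shows "L = M"
proof
  interpret L: Vector_Spaces.linear smult "(*)" L by (fact L)
  interpret M: Vector_Spaces.linear smult "(*)" M by (fact M)
  fix p
  show "L p = M p"
  proof (induction "degree p" arbitrary: p rule: less_induct)
    case less
    let ?t = "smult (lead_coeff p) (q_charlier a q (degree p))"
    have C: "degree (q_charlier a q (degree p)) = degree p"
      "coeff (q_charlier a q (degree p)) (degree p) = 1"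
      using degree_q_charlier_monic by auto
    have t: "L ?t = M ?t" by (simp add: L.scale M.scale eq)
    have "L (p - ?t) = M (p - ?t)"
    proof (cases "degree p = 0")
      case True
      then obtain c where "p = [:c:]" by (auto elim: degree_eq_zeroE)
      then have "p - ?t = 0" by simp
      then show ?thesis by (simp add: L.zero M.zero)
    next
      case False
      have "degree (p - ?t) < degree p"
      proof (rule degree_lessI)
        show "p - ?t \<noteq> 0 \<or> 0 < degree p" using False by simp
        show "\<forall>k\<ge>degree p. coeff (p - ?t) k = 0"
        proof (intro allI impI)
          fix k assume "degree p \<le> k"
          then show "coeff (p - ?t) k = 0"
            using C by (cases "k = degree p") (auto simp: coeff_eq_0)
        qed
      qed
      then show ?thesis by (rule less)
    qed
    then show ?case using t by (simp add: L.diff M.diff)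
  qed
qed

lemma q_charlier_functional_orthogonalI:
  fixes L :: "'k::field poly \<Rightarrow> 'k"
  assumes L: "Vector_Spaces.linear smult (*) L"
    and 0: "\<And>n. 0 < n \<Longrightarrow> L (q_charlier a q n) = 0" and mn: "m \<noteq> n"
  shows "L (q_charlier a q m * q_charlier a q n) = 0"
proof -
  interpret L: Vector_Spaces.linear smult "(*)" L by (fact L)
  let ?C = "q_charlier a q"
  have x: "[:0, 1:] * ?C (Suc n) = ?C (Suc (Suc n))
      + smult (a * q ^ Suc n + q_int q (Suc n)) (?C (Suc n))
      + smult (a * q_int q (Suc n) * q ^ n) (?C n)" for n
  proof -
    have "X * A = ((X - [:c:]) * A - B) + smult c A + B" for X A B :: "'k poly" and c
      by (simp add: left_diff_distrib)
    then show ?thesis unfolding q_charlier.simps(3) .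
  qed
  have mono: "L ([:0, 1:] ^ k * ?C n) = 0" if "k < n" for k n
    using that
  proof (induction k arbitrary: n)
    case (Suc k)
    then obtain m where m: "n = Suc m" "k < m" by (cases n) auto
    have "L ([:0, 1:] ^ Suc k * ?C n) = L ([:0, 1:] ^ k * ([:0, 1:] * ?C (Suc m)))"
      by (simp only: m power_Suc2 mult.assoc)
    also have "\<dots> = 0"
      unfolding x by (simp only: distrib_left mult_smult_right L.add L.scale)
        (use Suc.IH m in \<open>simp del: q_charlier.simps\<close>)
    finally show ?case .
  qed (use 0 in simp)
  have low: "L (p * ?C n) = 0" if "degree p < n" for p n
  proof -
    have "p * ?C n = (\<Sum>i\<le>degree p. smult (coeff p i) ([:0, 1:] ^ i * ?C n))"
      by (subst poly_as_sum_of_monoms[symmetric, of p])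
        (simp add: sum_distrib_right monom_altdef)
    then show ?thesis using that by (simp add: L.sum L.scale mono)
  qed
  show ?thesis
  proof (cases "m < n")
    case True
    then show ?thesis using low[of "?C m" n] degree_q_charlier_monic[of a q m] by simp
  next
    case False
    then have "n < m" using mn by simp
    then show ?thesis
      using low[of "?C n" m] degree_q_charlier_monic[of a q n] by (simp add: mult.commute)
  qed
qed

lemma linear_coeff_functional:
  fixes \<mu> :: "nat \<Rightarrow> 'k::field"
  shows "Vector_Spaces.linear smult (*) (\<lambda>p. \<Sum>i\<le>degree p. coeff p i * \<mu> i)"
    (is "Vector_Spaces.linear _ _ ?L")
proof -
  have ext: "?L p = (\<Sum>i\<le>N. coeff p i * \<mu> i)" if "degree p \<le> N" for p N
    by (rule sum.mono_neutral_left) (use that in \<open>auto simp: coeff_eq_0\<close>)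
  have add: "?L (p + r) = ?L p + ?L r" for p r
    using ext[of p "max (degree p) (degree r)"] ext[of r "max (degree p) (degree r)"]
      ext[OF degree_add_le_max, of p r]
    by (simp add: sum.distrib distrib_right)
  have scale: "?L (smult c p) = c * ?L p" for c p
    using ext[OF degree_smult_le, of c p] by (simp add: sum_distrib_left mult.assoc)
  show ?thesis
    by unfold_locales (rule add scale | simp add: smult_add_right smult_add_left algebra_simps)+
qed

lemma q_charlier_functional_ex1: "\<exists>!L. is_q_charlier_functional a q L"
proof (rule ex_ex1I)
  let ?C = "q_charlier a q" and ?\<mu> = "q_charlier_moment a q"
  define L where "L = (\<lambda>p. \<Sum>i\<le>degree p. coeff p i * ?\<mu> i)"
  have lin: "Vector_Spaces.linear smult (*) L"
    unfolding L_def by (rule linear_coeff_functional)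
  have "L (?C n) = 0" if "0 < n" for n
  proof -
    have "L (?C n) = (\<Sum>i<n. coeff (?C n) i * ?\<mu> i) + ?\<mu> n"
      using degree_q_charlier_monic[of a q n]
      by (simp add: L_def lessThan_Suc_atMost[symmetric])
    then show ?thesis using that q_charlier_moment.simps[of a q n] by simp
  qed
  moreover have "L 1 = 1" by (simp add: L_def q_charlier_moment.simps[of _ _ 0])
  ultimately have "is_q_charlier_functional a q L"
    using lin q_charlier_functional_orthogonalI[OF lin]
    unfolding is_q_charlier_functional_def by blast
  then show "\<exists>L. is_q_charlier_functional a q L" by blast
next
  have C: "L (q_charlier a q n) = (if n = 0 then 1 else 0)"
    if "is_q_charlier_functional a q L" for L n
    using that q_charlier.simps(1)[of a q] unfolding is_q_charlier_functional_def
    by (metis mult.right_neutral)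
  fix L M
  assume "is_q_charlier_functional a q L" "is_q_charlier_functional a q M"
  then show "L = M"
    using linear_functional_eqI[of L M a q] C is_q_charlier_functional_def by metis
qed

end

theory Submission
  imports Defs
begin

text \<open>
  The \<open>q\<close>-integers are the orbit of \<open>0\<close> under \<open>x \<mapsto> 1 + q x\<close>. The divided difference \<open>D\<close> along this
  map lowers the degree, \<open>D C\<^sub>n = [n] C\<^sub>n\<^sub>-\<^sub>1\<close>, so orthogonality gives the Rodrigues-type formula
  \<open>L (C\<^sub>n p) = a\<^sup>n q\<^bsup>n choose 2\<^esup> L (D\<^sup>n p)\<close>. Apply it with \<open>n = n3\<close> to \<open>p = C\<^bsub>n2\<^esub> C\<^bsub>n1\<^esub>\<close> and expand by
  the \<open>q\<close>-Leibniz rule. This leaves products of a \<open>k\<close>-fold shifted \<open>C\<^sub>m\<close> with a \<open>C\<^sub>r\<close>; the Rodrigues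
  formula, used once more, reduces these to the numbers \<open>L (shift\<^sup>k C\<^sub>n)\<close>, whose exponential \<open>q\<close>-generating
  function in \<open>n\<close> is the finite product of the factors \<open>(1 + q\<^sup>i s) (1 + a (q - 1) q\<^sup>i s)\<close> for \<open>i < k\<close>.
  With \<open>k = n1 - j\<close> and \<open>l - j\<close> the exponent taken from the second kind of factors, the terms are
  those of the claimed sum.
\<close>

section \<open>q-integers and Gaussian binomials when q is not a root of unity\<close>

locale q_nonroot =
  fixes q :: "'k::field"
  assumes q_power_neq_1: "0 < n \<Longrightarrow> q ^ n \<noteq> 1"
begin

lemma q_neq_1: "q \<noteq> 1"
  using q_power_neq_1[of 1] by simp

lemma q_int_0 [simp]: "q_int q 0 = 0"
  by (simp add: q_int_def)

lemma one_minus_q_times_q_int: "(1 - q) * q_int q n = 1 - q ^ n"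
  using q_neq_1 by (simp add: q_int_def)

lemma q_int_Suc: "q_int q (Suc n) = 1 + q * q_int q n"
  using q_neq_1 by (simp add: q_int_def divide_simps) (simp add: algebra_simps)

lemma q_int_neq_0: "0 < n \<Longrightarrow> q_int q n \<noteq> 0"
  using q_power_neq_1[of n] q_neq_1 by (simp add: q_int_def)

lemma q_fact_0 [simp]: "q_fact q 0 = 1"
  by (simp add: q_fact_def)

lemma q_fact_Suc: "q_fact q (Suc n) = q_int q (Suc n) * q_fact q n"
  by (simp add: q_fact_def prod.nat_ivl_Suc' mult.commute)

lemma q_fact_neq_0 [simp]: "q_fact q n \<noteq> 0"
  by (simp add: q_fact_def q_int_neq_0)

lemma q_binomial_0 [simp]: "q_binomial q n 0 = 1"
  by (simp add: q_binomial_def)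

lemma q_binomial_eq_0 [simp]: "n < k \<Longrightarrow> q_binomial q n k = 0"
  by (simp add: q_binomial_def)

lemma q_int_add: "q_int q (m + n) = q_int q m + q ^ m * q_int q n"
  using q_neq_1 by (simp add: q_int_def divide_simps) (simp add: algebra_simps power_add)

text \<open>Rests on the splitting [n+1] = [k+1] + q^(k+1) [n-k] from
  \<open>q_int_add\<close>.\<close>

lemma q_binomial_Suc_Suc:
  "q_binomial q (Suc n) (Suc k) = q_binomial q n k + q ^ Suc k * q_binomial q n (Suc k)"
proof -
  consider "n < k" | "n = k" | d where "n = Suc k + d"
    by (metis less_iff_Suc_add linorder_neqE_nat add_Suc)
  then show ?thesis
  proof cases
    case 3
    have e: "Suc n - Suc k = Suc d" "n - k = Suc d" "n - Suc k = d" using 3 by auto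
    have "q_int q (Suc n) = q_int q (Suc k) + q ^ Suc k * q_int q (Suc d)"
      using q_int_add[of "Suc k" "Suc d"] 3 by simp
    then show ?thesis
      using 3 q_int_neq_0[of "Suc d"] q_int_neq_0[of "Suc k"]
      unfolding q_binomial_def e
      by (simp add: q_fact_Suc divide_simps) (simp add: algebra_simps)
  qed (auto simp: q_binomial_def)
qed

subsection \<open>Shift and divided difference\<close>

definition shift :: "'k poly \<Rightarrow> 'k poly" where
  "shift p = p \<circ>\<^sub>p [:1, q:]"

lemma shift_simps [simp]:
  "shift 0 = 0" "shift 1 = 1" "shift (p + r) = shift p + shift r"
  "shift (p - r) = shift p - shift r" "shift (p * r) = shift p * shift r"
  "shift (smult c p) = smult c (shift p)"
  by (simp_all add: shift_def pcompose_add pcompose_diff pcompose_mult pcompose_smult pcompose_1)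

abbreviation x_minus_shift :: "'k poly" where
  "x_minus_shift \<equiv> [:-1, 1 - q:]"

lemma x_minus_shift_neq_0: "x_minus_shift \<noteq> 0" by simp

lemma shift_x_minus_shift: "shift x_minus_shift = smult q x_minus_shift"
  by (simp add: shift_def pcompose_pCons algebra_simps)

definition qderiv :: "'k poly \<Rightarrow> 'k poly" where
  "qderiv p = (p - shift p) div x_minus_shift"

text \<open>The fixed point 1/(1-q) of x -> 1 + q x is a root of p - \<open>shift p\<close> for
  every p, so the division in \<open>qderiv\<close> is exact.\<close>

lemma x_minus_shift_qderiv: "x_minus_shift * qderiv p = p - shift p"
proof -
  let ?x = "1 / (1 - q)"
  have "1 + ?x * q = ?x"
    using q_neq_1 by (simp add: divide_simps)
  then have "poly (p - shift p) ?x = 0"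
    by (simp add: shift_def poly_pcompose)
  then have "[:- ?x, 1:] dvd p - shift p"
    by (simp only: poly_eq_0_iff_dvd)
  moreover have "x_minus_shift = smult (1 - q) [:- ?x, 1:]"
    using q_neq_1 by simp
  ultimately have "x_minus_shift dvd p - shift p"
    using q_neq_1 by (metis right_minus_eq smult_dvd)
  then show ?thesis
    unfolding qderiv_def by (rule dvd_mult_div_cancel)
qed

text \<open>Lets rules for \<open>qderiv\<close> be checked after multiplying by
  \<open>x_minus_shift\<close>, without touching \<open>div\<close>.\<close>

lemma qderivI: "x_minus_shift * r = p - shift p \<Longrightarrow> qderiv p = r"
  using x_minus_shift_qderiv[of p] x_minus_shift_neq_0 by (metis mult_left_cancel)

lemma qderiv_simps [simp]:
  "qderiv 0 = 0" "qderiv 1 = 0" "qderiv (p + r) = qderiv p + qderiv r"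
  "qderiv (smult c p) = smult c (qderiv p)"
  by (rule qderivI; simp add: x_minus_shift_qderiv distrib_left smult_diff_right del: mult_pCons_left)+

lemma qderiv_mult: "qderiv (p * r) = qderiv p * r + shift p * qderiv r"
proof (rule qderivI)
  have "x_minus_shift * (qderiv p * r + shift p * qderiv r) = (x_minus_shift * qderiv p) * r + shift p * (x_minus_shift * qderiv r)"
    by (simp only: algebra_simps)
  then show "x_minus_shift * (qderiv p * r + shift p * qderiv r) = p * r - shift (p * r)"
    unfolding x_minus_shift_qderiv by (simp add: algebra_simps)
qed

text \<open>The factor q comes from the denominator, which the shift scales by q.\<close>

lemma qderiv_shift: "qderiv (shift p) = smult q (shift (qderiv p))"
proof (rule qderivI)
  have "x_minus_shift * smult q (shift (qderiv p)) = shift (x_minus_shift * qderiv p)"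
    by (simp only: shift_simps shift_x_minus_shift mult_smult_left mult_smult_right)
  then show "x_minus_shift * smult q (shift (qderiv p)) = shift p - shift (shift p)"
    unfolding x_minus_shift_qderiv by simp
qed

lemma qderiv_sum: "qderiv (sum f A) = (\<Sum>i\<in>A. qderiv (f i))"
  by (induction A rule: infinite_finite_induct) simp_all

lemma funpow_shift_simps [simp]:
  "(shift ^^ k) 0 = 0" "(shift ^^ k) (p + r) = (shift ^^ k) p + (shift ^^ k) r"
  "(shift ^^ k) (smult c p) = smult c ((shift ^^ k) p)"
  by (induction k) simp_all

lemma funpow_qderiv_simps [simp]:
  "(qderiv ^^ n) 0 = 0" "(qderiv ^^ n) (p + r) = (qderiv ^^ n) p + (qderiv ^^ n) r"
  "(qderiv ^^ n) (smult c p) = smult c ((qderiv ^^ n) p)"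
  by (induction n) simp_all

lemma qderiv_funpow_shift: "qderiv ((shift ^^ k) p) = smult (q ^ k) ((shift ^^ k) (qderiv p))"
  by (induction k) (simp_all add: qderiv_shift mult.commute)

lemma funpow_qderiv_funpow_shift:
  "(qderiv ^^ r) ((shift ^^ k) p) = smult (q ^ (k * r)) ((shift ^^ k) ((qderiv ^^ r) p))"
  by (induction r) (simp_all add: qderiv_funpow_shift power_add mult.commute)

text \<open>A q-Leibniz rule: moving \<open>qderiv\<close> past k shifts costs q^k, which is the
  weight in the q-Pascal rule \<open>q_binomial_Suc_Suc\<close>.\<close>

lemma funpow_qderiv_mult:
  "(qderiv ^^ n) (p * r) =
     (\<Sum>k\<le>n. smult (q_binomial q n k) ((shift ^^ k) ((qderiv ^^ (n - k)) p) * (qderiv ^^ k) r))"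
proof (induction n)
  case (Suc n)
  define T where "T i k = (shift ^^ k) ((qderiv ^^ i) p) * (qderiv ^^ k) r" for i k
  let ?b = "q_binomial q n"
  have D: "qderiv (T i k) = smult (q ^ k) (T (Suc i) k) + T i (Suc k)" for i k
    unfolding T_def qderiv_mult by (simp add: qderiv_funpow_shift)
  have "(qderiv ^^ Suc n) (p * r) = (\<Sum>k\<le>n. smult (?b k) (qderiv (T (n - k) k)))"
    using Suc by (simp add: qderiv_sum T_def)
  also have "\<dots> = (\<Sum>k\<le>n. smult (q ^ k * ?b k) (T (Suc n - k) k))
      + (\<Sum>k\<le>n. smult (?b k) (T (n - k) (Suc k)))"
    by (simp add: D smult_add_right sum.distrib Suc_diff_le mult.commute)
  \<comment> \<open>The extra term k = n + 1 has q-binomial 0; with it the sum can be split at k = 0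
    and reindexed.\<close>
  also have "(\<Sum>k\<le>n. smult (q ^ k * ?b k) (T (Suc n - k) k))
      = (\<Sum>k\<le>Suc n. smult (q ^ k * ?b k) (T (Suc n - k) k))"
    by simp
  also have "\<dots> = T (Suc n) 0 + (\<Sum>k\<le>n. smult (q ^ Suc k * ?b (Suc k)) (T (n - k) (Suc k)))"
    by (subst sum.atMost_Suc_shift) simp
  also have "\<dots> + (\<Sum>k\<le>n. smult (?b k) (T (n - k) (Suc k)))
      = T (Suc n) 0 + (\<Sum>k\<le>n. smult (q_binomial q (Suc n) (Suc k)) (T (n - k) (Suc k)))"
    by (simp add: q_binomial_Suc_Suc smult_add_left sum.distrib add_ac)
  also have "\<dots> = (\<Sum>k\<le>Suc n. smult (q_binomial q (Suc n) k) (T (Suc n - k) k))"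
    by (subst sum.atMost_Suc_shift) simp
  finally show ?case by (simp add: T_def)
qed simp

section \<open>Finite q-products and Gauss's binomial theorem\<close>

definition q_pochhammer :: "'k \<Rightarrow> nat \<Rightarrow> 'k poly" where
  "q_pochhammer y k = (\<Prod>i<k. [:1, y * q ^ i:])"

lemma q_pochhammer_0 [simp]: "q_pochhammer y 0 = 1"
  by (simp add: q_pochhammer_def)

text \<open>Removing the factor i = 0 leaves a product with one factor fewer, evaluated at q s,
  where s is the polynomial variable.\<close>

lemma q_pochhammer_Suc: "q_pochhammer y (Suc k) = [:1, y:] * (q_pochhammer y k \<circ>\<^sub>p [:0, q:])"
  unfolding q_pochhammer_def pcompose_prod
  by (subst prod.lessThan_Suc_shift) (simp add: pcompose_pCons mult_ac)

text \<open>Comparing coefficients in \<open>q_pochhammer_Suc\<close> gives the q-Pascal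
  recursion.\<close>

lemma coeff_q_pochhammer: "coeff (q_pochhammer y k) i = y ^ i * q ^ (i choose 2) * q_binomial q k i"
proof (induction k arbitrary: i)
  case 0
  show ?case by (cases i) (auto simp: numeral_2_eq_2)
next
  case (Suc k)
  show ?case
  proof (cases i)
    case 0
    then show ?thesis
      using Suc[of 0] by (simp add: q_pochhammer_Suc coeff_pcompose_linear numeral_2_eq_2 poly_0_coeff_0)
  next
    case (Suc j)
    have "Suc j choose 2 = (j choose 2) + j"
      by (simp add: numeral_2_eq_2)
    then show ?thesis
      using Suc by (simp add: q_pochhammer_Suc coeff_pcompose_linear Suc.IH q_binomial_Suc_Suc)
        (simp add: algebra_simps power_add)
  qed
qed

end

text \<open>The induction step of \<open>shift_C\<close>, in an abstract ring to keep it purely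
  algebraic. Read X as x, S as the shift of x, P as q^m, N0, N1, N2 as [m], [m+1], [m+2], Cm to C2
  as C_(m-1) to C_(m+2), and D0, D1 as the shifts of C_m, C_(m+1). The hypothesis on
  \<open>Q * c0\<close> avoids the exponent m - 1.\<close>

lemma q_charlier_shift_identity:
  fixes X S W Q A P N0 N1 N2 c0 Cm C0 C1 C2 D0 D1 :: "'a::comm_ring_1"
  assumes "S = 1 + Q * X" "W = S - X" "N1 = 1 + Q * N0" "N2 = 1 + Q * N1" "Q * c0 = A * N0 * P"
    and "C1 = (X - (A * P + N0)) * C0 - c0 * Cm"
    and "C2 = (X - (A * (Q * P) + N1)) * C1 - A * N1 * P * C0"
    and "D0 = C0 + N0 * W * Cm" "D1 = C1 + N1 * W * C0"
  shows "(S - (A * (Q * P) + N1)) * D1 - A * N1 * P * D0 = C2 + N2 * W * C1"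
proof -
  \<comment> \<open>The recurrence for C1 times Q, with Q X traded for S - 1; it makes the last
    factor below collapse to (1 + Q N0 - N1) C0 = 0.\<close>
  have *: "Q * C1 = (S - 1 - Q * (A * P + N0)) * C0 - A * N0 * P * Cm"
    unfolding assms(6) using assms(1,5) by (simp add: algebra_simps)
  have "(S - (A * (Q * P) + N1)) * D1 - A * N1 * P * D0 - (C2 + N2 * W * C1)
      = W * N1 * (- (Q * C1) + (S - (A * (Q * P) + N1)) * C0 - A * P * N0 * Cm)"
    unfolding assms(7,8,9,4) assms(2) by (simp add: algebra_simps)
  also have "\<dots> = 0"
    unfolding * assms(3) by (simp add: algebra_simps)
  finally show ?thesis by simp
qed

lemma linear_smult_timesI:
  fixes L :: "'k::field poly \<Rightarrow> 'k"
  assumes "\<And>p r. L (p + r) = L p + L r" "\<And>c p. L (smult c p) = c * L p"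
  shows "Vector_Spaces.linear smult (*) L"
  by unfold_locales (simp_all add: assms smult_add_right smult_add_left algebra_simps)

subsection \<open>Moments of shifted \<open>q\<close>-Charlier polynomials\<close>

locale q_charlier_moments = q_nonroot q for q :: "'k::field" +
  fixes a :: 'k and L :: "'k poly \<Rightarrow> 'k"
  assumes functional: "is_q_charlier_functional a q L"
begin

abbreviation C :: "nat \<Rightarrow> 'k poly" where "C \<equiv> q_charlier a q"

lemma L_add: "L (p + r) = L p + L r"
  and L_scale: "L (smult c p) = c * L p"
  and L_zero: "L 0 = 0"
  and L_sum: "L (sum f A) = (\<Sum>i\<in>A. L (f i))"
proof -
  interpret L: Vector_Spaces.linear smult "(*)" L
    using functional by (simp add: is_q_charlier_functional_def)
  show "L (p + r) = L p + L r" "L (smult c p) = c * L p" "L 0 = 0"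
    "L (sum f A) = (\<Sum>i\<in>A. L (f i))"
    by (rule L.add L.scale L.zero L.sum)+
qed

lemma L_1: "L 1 = 1"
  and L_orthogonal: "m \<noteq> n \<Longrightarrow> L (C m * C n) = 0"
  using functional by (simp_all add: is_q_charlier_functional_def)

lemma L_C: "L (C n) = (if n = 0 then 1 else 0)"
  using L_orthogonal[of n 0] L_1 by auto

text \<open>At n = 0 the truncated index n - 1 is harmless because [0] = 0.\<close>

lemma C_Suc: "C (Suc n) = ([:0, 1:] - [:a * q ^ n + q_int q n:]) * C n
    - smult (a * q_int q n * q ^ (n - 1)) (C (n - 1))"
  by (cases n) simp_all

lemma x_mult_C: "[:0, 1:] * C n = C (Suc n)
    + (smult (a * q ^ n + q_int q n) (C n) + smult (a * q_int q n * q ^ (n - 1)) (C (n - 1)))"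
proof -
  have "X * A = ((X - [:c:]) * A - B) + (smult c A + B)" for X A B :: "'k poly" and c
    by (simp add: left_diff_distrib)
  then show ?thesis unfolding C_Suc .
qed

text \<open>This is \<open>qderiv_C\<close> with the denominator cleared,
  \<open>[:1, q - 1:]\<close> being the negative of \<open>x_minus_shift\<close>. The three-term
  recurrence carries it from two consecutive indices to the next.\<close>

lemma shift_C: "shift (C n) = C n + smult (q_int q n) ([:1, q - 1:] * C (n - 1))"
proof (induction n rule: less_induct)
  case (less n)
  consider "n = 0" | "n = 1" | m where "n = Suc (Suc m)"
    by (metis One_nat_def old.nat.exhaust)
  then show ?case
  proof cases
    case 2
    have "q_int q 1 = 1" using q_int_Suc[of 0] by simp
    then show ?thesis
      using 2 by (simp add: shift_def pcompose_pCons q_int_Suc)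
  next
    case 3
    \<comment> \<open>Scalars become constant polynomials, so that the abstract identity applies in
      the polynomial ring.\<close>
    have smult_const: "smult c p = [:c:] * p" for c and p :: "'k poly"
      by simp
    have smult_mult: "smult c (r * p) = [:c:] * r * p" for c and r p :: "'k poly"
      by (simp only: smult_const[of c] mult.assoc)
    have smult_split: "smult (a * q_int q (Suc m) * q ^ m) p
        = [:a:] * [:q_int q (Suc m):] * [:q ^ m:] * p" for p
      by (simp add: mult_ac)
    have const_split: "[:a * q ^ Suc m + q_int q (Suc m):]
        = [:a:] * ([:q:] * [:q ^ m:]) + [:q_int q (Suc m):]"
      by simp
    let ?c = "a * q_int q m * q ^ (m - 1)"
    have eq: "([:1, q:] - ([:a:] * ([:q:] * [:q ^ m:]) + [:q_int q (Suc m):])) * shift (C (Suc m))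
          - [:a:] * [:q_int q (Suc m):] * [:q ^ m:] * shift (C m)
        = C (Suc (Suc m)) + [:q_int q (Suc (Suc m)):] * [:1, q - 1:] * C (Suc m)"
    proof (rule q_charlier_shift_identity)
      show "[:1, q:] = 1 + [:q:] * [:0, 1:]" by (simp add: one_pCons)
      show "[:1, q - 1:] = [:1, q:] - [:0, 1:]" by simp
      show "[:q_int q (Suc m):] = 1 + [:q:] * [:q_int q m:]"
        "[:q_int q (Suc (Suc m)):] = 1 + [:q:] * [:q_int q (Suc m):]"
        by (simp_all add: q_int_Suc one_pCons)
      show "[:q:] * [:?c:] = [:a:] * [:q_int q m:] * [:q ^ m:]"
        by (cases m) simp_all
      show "C (Suc m) = ([:0, 1:] - ([:a:] * [:q ^ m:] + [:q_int q m:])) * C m - [:?c:] * C (m - 1)"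
        unfolding C_Suc[of m] by (simp add: mult_ac)
      show "C (Suc (Suc m)) = ([:0, 1:] - ([:a:] * ([:q:] * [:q ^ m:]) + [:q_int q (Suc m):])) * C (Suc m)
          - [:a:] * [:q_int q (Suc m):] * [:q ^ m:] * C m"
        by (simp only: q_charlier.simps(3) smult_split const_split)
      show "shift (C m) = C m + [:q_int q m:] * [:1, q - 1:] * C (m - 1)"
        using less[of m] 3 by (simp only: smult_mult less_Suc_eq simp_thms)
      show "shift (C (Suc m)) = C (Suc m) + [:q_int q (Suc m):] * [:1, q - 1:] * C m"
        using less[of "Suc m"] 3 by (simp only: smult_mult less_Suc_eq diff_Suc_1 simp_thms)
    qed
    have "shift ([:0, 1:] - [:a * q ^ Suc m + q_int q (Suc m):])
        = [:1, q:] - ([:a:] * ([:q:] * [:q ^ m:]) + [:q_int q (Suc m):])"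
      by (simp add: shift_def pcompose_pCons)
    moreover have "shift (u * p - smult c r) = shift u * shift p - smult c (shift r)" for u p c r
      by simp
    ultimately have "shift (C n) = ([:1, q:] - ([:a:] * ([:q:] * [:q ^ m:]) + [:q_int q (Suc m):])) * shift (C (Suc m))
        - [:a:] * [:q_int q (Suc m):] * [:q ^ m:] * shift (C m)"
      unfolding 3 q_charlier.simps(3)[of a q m] smult_split[symmetric] by (simp only:)
    then show ?thesis
      unfolding eq unfolding 3 diff_Suc_1 smult_mult .
  qed simp
qed

lemma qderiv_C: "qderiv (C n) = smult (q_int q n) (C (n - 1))"
proof (rule qderivI)
  have "[:1, q - 1:] = - x_minus_shift" by simp
  then have "smult c ([:1, q - 1:] * p) = - (x_minus_shift * smult c p)" for c p
    by (simp only: mult_smult_right mult_minus_left smult_minus_right)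
  moreover have cancel: "x - (x + - y) = y" for x y :: "'k poly"
    by simp
  ultimately show "x_minus_shift * smult (q_int q n) (C (n - 1)) = C n - shift (C n)"
    unfolding shift_C by (simp only: cancel)
qed

lemma funpow_qderiv_C:
  "(qderiv ^^ s) (C m) = (if s \<le> m then smult (q_fact q m / q_fact q (m - s)) (C (m - s)) else 0)"
proof (induction s)
  case (Suc s)
  show ?case
  proof (cases "Suc s \<le> m")
    case True
    then have "m - s = Suc (m - Suc s)" by simp
    then have "q_fact q (m - s) = q_int q (m - s) * q_fact q (m - Suc s)"
      using q_fact_Suc[of "m - Suc s"] by simp
    then show ?thesis
      using True Suc q_int_neq_0[of "m - s"] by (simp add: qderiv_C)
  next
    case False
    then show ?thesis
      using Suc by (cases "s = m") (simp_all add: qderiv_C del: q_charlier.simps)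
  qed
qed simp

text \<open>Follows from the expansion of x C_n and 1 - (1-q) [n] = q^n. Under \<open>L\<close> it
  yields a recursion in the number of shifts.\<close>

lemma shift_C_Suc:
  "shift (C (Suc n)) = smult (q ^ Suc n) (C (Suc n))
     + smult (q_int q (Suc n) * q ^ n * (1 + a * (q - 1))) (C n)
     + smult (q_int q (Suc n) * q_int q n * q ^ (n - 1) * (a * (q - 1))) (C (n - 1))"
proof -
  let ?N = "q_int q (Suc n)" and ?b = "a * q ^ n + q_int q n"
    and ?c = "a * q_int q n * q ^ (n - 1)"
  have x: "[:0, 1:] * C n = C (Suc n) + smult ?b (C n) + smult ?c (C (n - 1))"
    by (simp only: x_mult_C add.assoc)
  have expand: "z + smult d (smult e y + smult f z + smult g t)
      = smult (d * e) y + smult (1 + d * f) z + smult (d * g) t"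
    "z + smult d (smult e z + smult f y + smult g t)
      = smult (1 + d * e) z + smult (d * f) y + smult (d * g) t" for d e f g and y z t :: "'k poly"
    by (simp_all add: smult_add_right smult_add_left)
  have "[:1, q - 1:] * C n = C n + smult (q - 1) ([:0, 1:] * C n)"
    by simp
  also have "\<dots> = smult (q - 1) (C (Suc n)) + smult (1 + (q - 1) * ?b) (C n)
      + smult ((q - 1) * ?c) (C (n - 1))"
    unfolding x using expand(1)[of "C n" "q - 1" 1 "C (Suc n)"]
    by (simp only: smult_1_left mult_1_right)
  finally have 1: "[:1, q - 1:] * C n = \<dots>" .
  have "1 + ?N * (q - 1) = 1 - (1 - q) * ?N"
    by (simp add: algebra_simps)
  then have 2: "1 + ?N * (q - 1) = q ^ Suc n"
    unfolding one_minus_q_times_q_int by simp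
  have "1 + (q - 1) * ?b = 1 - (1 - q) * q_int q n + (q - 1) * a * q ^ n"
    by (simp add: algebra_simps)
  also have "\<dots> = q ^ n * (1 + a * (q - 1))"
    unfolding one_minus_q_times_q_int by (simp add: algebra_simps)
  finally have 3: "1 + (q - 1) * ?b = q ^ n * (1 + a * (q - 1))" .
  have "?N * (q ^ n * (1 + a * (q - 1))) = ?N * q ^ n * (1 + a * (q - 1))"
    and "?N * ((q - 1) * ?c) = ?N * q_int q n * q ^ (n - 1) * (a * (q - 1))"
    by (simp_all only: mult_ac)
  then show ?thesis
    unfolding shift_C diff_Suc_1 1 3 by (simp only: expand(2) 2)
qed

text \<open>Evaluating L(x C_n C_(n+1)) by expanding either x C_n or x C_(n+1) shows that
  consecutive norms differ by the factor a [n+1] q^n.\<close>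

lemma L_C_squared: "L (C n * C n) = a ^ n * q ^ (n choose 2) * q_fact q n"
proof (induction n)
  case 0
  show ?case by (simp add: L_1 numeral_2_eq_2)
next
  case (Suc n)
  have "L (C (Suc n) * ([:0, 1:] * C n)) = L (C (Suc n) * C (Suc n))"
    unfolding x_mult_C by (simp add: distrib_left L_add L_scale L_orthogonal del: q_charlier.simps)
  moreover have "L (([:0, 1:] * C (Suc n)) * C n) = a * q_int q (Suc n) * q ^ n * L (C n * C n)"
    unfolding x_mult_C by (simp add: distrib_right L_add L_scale L_orthogonal del: q_charlier.simps)
  ultimately have "L (C (Suc n) * C (Suc n)) = a * q_int q (Suc n) * q ^ n * L (C n * C n)"
    by (simp only: mult.left_commute mult.commute mult.assoc)
  moreover have "Suc n choose 2 = (n choose 2) + n"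
    by (simp add: numeral_2_eq_2)
  ultimately show ?case
    by (simp only: Suc q_fact_Suc power_add power_Suc) (simp add: mult_ac)
qed

text \<open>Both sides are linear in p, so p = C_m suffices. There orthogonality kills all but m = n
  + 1, which is the ratio of consecutive norms.\<close>

lemma L_C_Suc_mult: "L (C (Suc n) * p) = a * q ^ n * L (C n * qderiv p)"
proof -
  have "(\<lambda>p. L (C (Suc n) * p)) = (\<lambda>p. a * q ^ n * L (C n * qderiv p))"
  proof (rule linear_functional_eqI)
    show "L (C (Suc n) * C m) = a * q ^ n * L (C n * qderiv (C m))" for m
    proof (cases "m = Suc n")
      case True
      moreover have "Suc n choose 2 = (n choose 2) + n"
        by (simp add: numeral_2_eq_2)
      ultimately show ?thesis
        by (simp add: qderiv_C L_scale L_C_squared q_fact_Suc power_add mult_ac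
            del: q_charlier.simps)
    next
      case False
      then show ?thesis
        by (cases m) (simp_all add: qderiv_C L_scale L_zero L_orthogonal del: q_charlier.simps)
    qed
  qed (rule linear_smult_timesI;
      simp add: L_add L_scale algebra_simps del: q_charlier.simps)+
  then show ?thesis by (rule fun_cong)
qed

text \<open>Iterating \<open>L_C_Suc_mult\<close> collects the exponent 0 + 1 + ... + (n-1) of
  q.\<close>

lemma L_C_mult: "L (C n * p) = a ^ n * q ^ (n choose 2) * L ((qderiv ^^ n) p)"
proof (induction n arbitrary: p)
  case 0
  show ?case by (simp add: numeral_2_eq_2)
next
  case (Suc n)
  have "Suc n choose 2 = (n choose 2) + n"
    by (simp add: numeral_2_eq_2)
  then show ?case
    unfolding L_C_Suc_mult Suc funpow_Suc_right by (simp add: power_add mult_ac)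
qed

section \<open>The generating function of the shifted moments\<close>

abbreviation shift_gf :: "nat \<Rightarrow> 'k poly" where
  "shift_gf k \<equiv> q_pochhammer 1 k * q_pochhammer (a * (q - 1)) k"

lemma shift_gf_Suc: "shift_gf (Suc k) = [:1, 1 + a * (q - 1), a * (q - 1):] * (shift_gf k \<circ>\<^sub>p [:0, q:])"
proof -
  have "shift_gf (Suc k) = ([:1, 1:] * [:1, a * (q - 1):]) * (shift_gf k \<circ>\<^sub>p [:0, q:])"
    unfolding q_pochhammer_Suc pcompose_mult by (simp only: mult_ac)
  also have "[:1, 1:] * [:1, a * (q - 1):] = [:1, 1 + a * (q - 1), a * (q - 1):]"
    by simp
  finally show ?thesis .
qed

text \<open>Divided by [n]!, the recursion from \<open>shift_C_Suc\<close> is the coefficient form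
  of \<open>shift_gf_Suc\<close>; its powers q^n, q^(n-1), q^(n-2) come from the substitution of q s
  for s.\<close>

lemma L_funpow_shift_C: "L ((shift ^^ k) (C n)) = q_fact q n * coeff (shift_gf k) n"
proof (induction k arbitrary: n)
  case 0
  show ?case by (simp add: L_C)
next
  case (Suc k)
  define P where "P = shift_gf k"
  let ?A = "a * (q - 1)"
  have IH: "L ((shift ^^ k) (C n)) = q_fact q n * coeff P n" for n
    unfolding P_def by (rule Suc)
  have P: "shift_gf (Suc k) = [:1, 1 + ?A, ?A:] * (P \<circ>\<^sub>p [:0, q:])"
    unfolding P_def by (rule shift_gf_Suc)
  show ?case
  proof (cases n)
    case 0
    then show ?thesis
      using IH[of 0] unfolding 0 P funpow_Suc_right
      by (simp add: coeff_pcompose_linear poly_0_coeff_0)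
  next
    case n: (Suc m)
    \<comment> \<open>The innermost shift is expanded first, so that the hypothesis, known for every
      index, applies to the other k shifts.\<close>
    have L: "L ((shift ^^ Suc k) (C n)) = q ^ Suc m * (q_fact q (Suc m) * coeff P (Suc m))
        + q_int q (Suc m) * q ^ m * (1 + ?A) * (q_fact q m * coeff P m)
        + q_int q (Suc m) * q_int q m * q ^ (m - 1) * ?A * (q_fact q (m - 1) * coeff P (m - 1))"
      unfolding n funpow_Suc_right o_apply shift_C_Suc funpow_shift_simps L_add L_scale IH ..
    show ?thesis
    \<comment> \<open>For m = 0 the third term is removed by [0] = 0, not by its truncated index m -
      1.\<close>
    proof (cases m)
      case 0
      show ?thesis
        unfolding L P unfolding n 0
          by (simp add: coeff_pcompose_linear q_fact_Suc poly_0_coeff_0) (simp add: algebra_simps)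
    next
      case m: (Suc m')
      show ?thesis
        unfolding L P unfolding n m by (simp add: coeff_pcompose_linear q_fact_Suc) (simp add: algebra_simps)
    qed
  qed
qed

text \<open>By \<open>L_C_mult\<close> for C_r: the r derivatives pass the k shifts at cost q^(k r)
  and lower C_m to C_(m-r), whose [m-r]! cancels.\<close>

lemma L_funpow_shift_C_mult_C:
  "L ((shift ^^ k) (C m) * C r) =
     (if r \<le> m then a ^ r * q ^ (r choose 2) * q ^ (k * r) * q_fact q m * coeff (shift_gf k) (m - r) else 0)"
proof -
  have "L ((shift ^^ k) (C m) * C r) = L (C r * (shift ^^ k) (C m))"
    by (simp only: mult.commute)
  then show ?thesis
    by (simp add: L_C_mult funpow_qderiv_funpow_shift funpow_qderiv_C L_scale L_zero L_funpow_shift_C)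
qed

subsection \<open>The triple product\<close>

text \<open>The first two conditions say that neither factor is differentiated to 0, the third that
  the remaining pairing falls under the nonzero case of
  \<open>L_funpow_shift_C_mult_C\<close>.\<close>

lemma L_C_mult_C_mult_C:
  "L (C l * C m * C n) = a ^ n * q ^ (n choose 2) *
     (\<Sum>k\<le>n. if n - k \<le> m \<and> k \<le> l \<and> l - k \<le> m - (n - k) then
        q_binomial q n k * q_fact q m * (q_fact q l / q_fact q (l - k)) *
        a ^ (l - k) * q ^ ((l - k) choose 2) * q ^ (k * (l - k)) * coeff (shift_gf k) (m - (n - k) - (l - k))
      else 0)"
proof -
  have "L (C l * C m * C n) = L (C n * (C m * C l))"
    by (simp only: mult_ac)
  also have "\<dots> = a ^ n * q ^ (n choose 2) * (\<Sum>k\<le>n. q_binomial q n k *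
      L ((shift ^^ k) ((qderiv ^^ (n - k)) (C m)) * (qderiv ^^ k) (C l)))"
    by (simp only: L_C_mult funpow_qderiv_mult L_sum L_scale)
  also have "(\<Sum>k\<le>n. q_binomial q n k *
      L ((shift ^^ k) ((qderiv ^^ (n - k)) (C m)) * (qderiv ^^ k) (C l))) =
     (\<Sum>k\<le>n. if n - k \<le> m \<and> k \<le> l \<and> l - k \<le> m - (n - k) then
        q_binomial q n k * q_fact q m * (q_fact q l / q_fact q (l - k)) *
        a ^ (l - k) * q ^ ((l - k) choose 2) * q ^ (k * (l - k)) * coeff (shift_gf k) (m - (n - k) - (l - k))
      else 0)"
    by (intro sum.cong refl)
      (simp add: funpow_qderiv_C L_scale L_zero L_funpow_shift_C_mult_C)
  finally show ?thesis .
qed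

lemma coeff_shift_gf: "coeff (shift_gf k) n =
    (\<Sum>i\<le>n. (a * (q - 1)) ^ i * q ^ (i choose 2) * q_binomial q k i
      * (q ^ ((n - i) choose 2) * q_binomial q k (n - i)))"
proof -
  \<comment> \<open>Commuted so that the index i of the Cauchy product is the exponent of a (q -
    1).\<close>
  have "coeff (shift_gf k) n = coeff (q_pochhammer (a * (q - 1)) k * q_pochhammer 1 k) n"
    by (simp only: mult.commute)
  then show ?thesis by (simp add: coeff_mult coeff_q_pochhammer)
qed

end

section \<open>Matching the summands of the two formulas\<close>

lemma int_choose_two: "2 * int (n choose 2) = int n * (int n - 1)"
  by (induction n) (simp_all add: numeral_2_eq_2 algebra_simps)

text \<open>Here i = l - j, d = n3 - n1, e = n1 - n2, and h = n1 + n2 - n3 - l - j is the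
  complementary index of the Cauchy product.\<close>

lemma summand_exponent_eq:
  fixes j i h d e n1 n2 n3 :: nat
  assumes "n2 = 2 * j + i + h + d" "n1 = n2 + e" "n3 = n1 + d"
  shows "int (i choose 2) + int (n1 choose 2) + int j * (- int n3 - int j + 1)
       + int (j choose 2) + int ((2 * j + h + d) choose 2)
       + int ((d + j) * (d + e + j + i)) + int (j * (d + e + j + i))
     = int ((n3 choose 2) + (j choose 2) + (n1 - j) * j + (i choose 2) + (h choose 2))"
proof -
  have nj: "n1 - j = j + i + h + d + e" using assms by simp
  \<comment> \<open>Doubling replaces each binomial by n (n - 1) and leaves a polynomial identity
    over the integers.\<close>
  have "2 * (int (i choose 2) + int (n1 choose 2) + int j * (- int n3 - int j + 1)
       + int (j choose 2) + int ((2 * j + h + d) choose 2)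
       + int ((d + j) * (d + e + j + i)) + int (j * (d + e + j + i)))
     = 2 * int ((n3 choose 2) + (j choose 2) + (n1 - j) * j + (i choose 2) + (h choose 2))"
    unfolding distrib_left of_nat_add int_choose_two nj assms
    by (simp add: algebra_simps)
  then show ?thesis by simp
qed

text \<open>The variables \<open>d\<close>, \<open>e\<close>, \<open>h\<close> resolve the truncated subtractions of the summand.\<close>

lemma (in q_nonroot) summand_eq:
  fixes j i h d e n1 n2 n3 :: nat
  assumes n: "n2 = 2 * j + i + h + d" "n1 = n2 + e" "n3 = n1 + d" and l: "l = j + i"
  shows "a ^ (n3 + l) * q powi (int ((l - j) choose 2) + int (n1 choose 2) + int j * (- int n3 - int j + 1)
                + int (j choose 2) + int ((n2 + j - l) choose 2)
                + int ((n3 + j - n1) * (n3 + l - n2)) + int (j * (n3 + l - n2)))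
           * (q - 1) ^ (l - j)
           * (q_fact q (n1 - j) / q_fact q (n1 - l))
           * q_binomial q n2 (l - j) * q_fact q n3 * q_binomial q n1 j
           * q_binomial q (n2 + j - l) (n3 + j - n1)
           * (q_fact q j * q_fact q (n1 - j) / q_fact q (n3 + l - n2))
           * q_binomial q (n1 + n2 - n3 - l) j
       = a ^ n3 * q ^ (n3 choose 2) * (q_binomial q n3 (n1 - j) * q_fact q n2 * (q_fact q n1 / q_fact q j) *
           a ^ j * q ^ (j choose 2) * q ^ ((n1 - j) * j) *
           ((a * (q - 1)) ^ i * q ^ (i choose 2) * q_binomial q (n1 - j) i
            * (q ^ (h choose 2) * q_binomial q (n1 - j) h)))"
proof -
  have s: "l - j = i" "n2 + j - l = 2 * j + h + d" "n3 + j - n1 = d + j" "n3 + l - n2 = d + e + j + i"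
    "n1 + n2 - n3 - l = j + h" "n1 - l = j + h + d + e"
    using n l by simp_all
  have K: "q powi (int ((l - j) choose 2) + int (n1 choose 2) + int j * (- int n3 - int j + 1)
                + int (j choose 2) + int ((n2 + j - l) choose 2)
                + int ((n3 + j - n1) * (n3 + l - n2)) + int (j * (n3 + l - n2)))
     = q ^ (n3 choose 2) * q ^ (j choose 2) * q ^ ((n1 - j) * j) * q ^ (i choose 2) * q ^ (h choose 2)"
    unfolding s summand_exponent_eq[OF n] power_int_of_nat power_add ..
  have b: "q_binomial q n2 i = q_fact q n2 / (q_fact q i * q_fact q (2 * j + h + d))"
    "q_binomial q n1 j = q_fact q n1 / (q_fact q j * q_fact q (n1 - j))"
    "q_binomial q (2 * j + h + d) (d + j) = q_fact q (2 * j + h + d) / (q_fact q (d + j) * q_fact q (j + h))"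
    "q_binomial q (j + h) j = q_fact q (j + h) / (q_fact q j * q_fact q h)"
    "q_binomial q n3 (n1 - j) = q_fact q n3 / (q_fact q (n1 - j) * q_fact q (d + j))"
    "q_binomial q (n1 - j) i = q_fact q (n1 - j) / (q_fact q i * q_fact q (j + h + d + e))"
    "q_binomial q (n1 - j) h = q_fact q (n1 - j) / (q_fact q h * q_fact q (d + e + j + i))"
    using n by (simp_all add: q_binomial_def algebra_simps)
  have p: "a ^ (n3 + l) * (q - 1) ^ i = a ^ n3 * a ^ j * (a * (q - 1)) ^ i"
    by (simp add: l power_add power_mult_distrib mult_ac)
  have f: "q_fact q (n1 - j) / q_fact q (j + h + d + e)
      * (q_fact q n2 / (q_fact q i * q_fact q (2 * j + h + d))) * q_fact q n3
      * (q_fact q n1 / (q_fact q j * q_fact q (n1 - j)))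
      * (q_fact q (2 * j + h + d) / (q_fact q (d + j) * q_fact q (j + h)))
      * (q_fact q j * q_fact q (n1 - j) / q_fact q (d + e + j + i))
      * (q_fact q (j + h) / (q_fact q j * q_fact q h))
    = q_fact q n3 / (q_fact q (n1 - j) * q_fact q (d + j)) * q_fact q n2 * (q_fact q n1 / q_fact q j)
      * (q_fact q (n1 - j) / (q_fact q i * q_fact q (j + h + d + e)))
      * (q_fact q (n1 - j) / (q_fact q h * q_fact q (d + e + j + i)))"
    by (simp add: field_simps)
  \<comment> \<open>Separates the powers of a and q - 1 (for \<open>p\<close>), the powers of q, and
    the factorials (for \<open>f\<close>).\<close>
  have regroup: "x * y * z * t1 * t2 * t3 * t4 * t5 * t6 * t7
      = (x * z) * y * (t1 * t2 * t3 * t4 * t5 * t6 * t7)"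
    for x y z t1 t2 t3 t4 t5 t6 t7 :: 'k
    by (simp add: mult_ac)
  show ?thesis
    unfolding K unfolding s b unfolding regroup p f by (simp only: mult_ac)
qed

context q_charlier_moments
begin

lemma L_C_mult_C_mult_C_explicit:
  assumes n31: "n1 \<le> n3" and n12: "n2 \<le> n1"
  shows "L (C n1 * C n2 * C n3) =
    (\<Sum>l | n3 + l \<le> n1 + n2. \<Sum>j = 0..l.
       a ^ (n3 + l) * q powi (int ((l - j) choose 2) + int (n1 choose 2) + int j * (- int n3 - int j + 1)
                + int (j choose 2) + int ((n2 + j - l) choose 2)
                + int ((n3 + j - n1) * (n3 + l - n2)) + int (j * (n3 + l - n2)))
           * (q - 1) ^ (l - j)
           * (q_fact q (n1 - j) / q_fact q (n1 - l))
           * q_binomial q n2 (l - j) * q_fact q n3 * q_binomial q n1 j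
           * q_binomial q (n2 + j - l) (n3 + j - n1)
           * (q_fact q j * q_fact q (n1 - j) / q_fact q (n3 + l - n2))
           * q_binomial q (n1 + n2 - n3 - l) j)"
  (is "_ = (\<Sum>l | _. \<Sum>j = 0..l. ?R l j)")
proof -
  let ?N = "n1 + n2 - n3"
  define U where "U j = q_binomial q n3 (n1 - j) * q_fact q n2 * (q_fact q n1 / q_fact q j) *
      a ^ j * q ^ (j choose 2) * q ^ ((n1 - j) * j)" for j
  define V where "V j i = (a * (q - 1)) ^ i * q ^ (i choose 2) * q_binomial q (n1 - j) i
      * (q ^ ((?N - 2 * j - i) choose 2) * q_binomial q (n1 - j) (?N - 2 * j - i))" for j i
  let ?S = "{j. n3 + 2 * j \<le> n1 + n2}"
  have fin: "finite ?S" "finite {l. n3 + l \<le> n1 + n2}"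
    by (rule finite_subset[of _ "{..n1 + n2}"]; auto)+
  have R: "?R (j + i) j = a ^ n3 * q ^ (n3 choose 2) * (U j * V j i)"
    if "n3 + 2 * j + i \<le> n1 + n2" for j i
    unfolding U_def V_def
    by (rule summand_eq[where d = "n3 - n1" and e = "n1 - n2"]) (use that n31 n12 in simp_all)
  have "(\<Sum>k\<le>n3. if n3 - k \<le> n2 \<and> k \<le> n1 \<and> n1 - k \<le> n2 - (n3 - k) then
        q_binomial q n3 k * q_fact q n2 * (q_fact q n1 / q_fact q (n1 - k)) *
        a ^ (n1 - k) * q ^ ((n1 - k) choose 2) * q ^ (k * (n1 - k))
          * coeff (shift_gf k) (n2 - (n3 - k) - (n1 - k))
      else 0) = (\<Sum>j\<in>?S. U j * coeff (shift_gf (n1 - j)) (?N - 2 * j))"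
  \<comment> \<open>Under k = n1 - j the three conditions reduce to n3 + 2 j <= n1 + n2.\<close>
  proof (subst sum.inter_filter[symmetric], simp,
      rule sum.reindex_bij_witness[where i = "\<lambda>j. n1 - j" and j = "\<lambda>k. n1 - k"], goal_cases)
    case (5 k)
    then have "n2 - (n3 - k) - (n1 - k) = ?N - 2 * (n1 - k)" "n1 - (n1 - k) = k"
      using n31 n12 by auto
    then show ?case by (simp add: U_def)
  qed (use n31 n12 in auto)
  also have "\<dots> = (\<Sum>j\<in>?S. \<Sum>i\<le>?N - 2 * j. U j * V j i)"
    by (simp add: coeff_shift_gf V_def sum_distrib_left)
  finally have "L (C n1 * C n2 * C n3)
      = (\<Sum>j\<in>?S. \<Sum>i\<le>?N - 2 * j. a ^ n3 * q ^ (n3 choose 2) * (U j * V j i))"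
    by (simp add: L_C_mult_C_mult_C sum_distrib_left)
  also have "\<dots> = (\<Sum>j\<in>?S. \<Sum>i\<le>?N - 2 * j. ?R (j + i) j)"
    by (intro sum.cong refl R[symmetric]) auto
  also have "\<dots> = (\<Sum>(j, i)\<in>Sigma ?S (\<lambda>j. {..?N - 2 * j}). ?R (j + i) j)"
    by (subst sum.Sigma) (use fin in auto)
  also have "\<dots> = (\<Sum>(l, j)\<in>Sigma {l. n3 + l \<le> n1 + n2} (\<lambda>l. {0..l}). ?R l j)"
  \<comment> \<open>With l = j + i the left side covers exactly the pairs with l + j <= n1 + n2 -
    n3; in all others on the right the last q-binomial is 0.\<close>
  proof (rule sum.reindex_bij_witness_not_neutral
      [where i = "\<lambda>(l, j). (j, l - j)" and j = "\<lambda>(j, i). (j + i, j)" and S' = "{}"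
         and T' = "{(l, j) \<in> Sigma {l. n3 + l \<le> n1 + n2} (\<lambda>l. {0..l}). ?N < l + j}"],
      goal_cases)
    case 2
    show ?case
      by (rule finite_subset[of _ "Sigma {l. n3 + l \<le> n1 + n2} (\<lambda>l. {0..l})"]) (use fin in auto)
  qed auto
  also have "\<dots> = (\<Sum>l | n3 + l \<le> n1 + n2. \<Sum>j = 0..l. ?R l j)"
    by (subst sum.Sigma) (use fin in auto)
  finally show ?thesis .
qed

end

section \<open>Specialization to the field of rational functions\<close>

lemma q_nonroot_indet_q: "q_nonroot indet_q"
proof
  fix n :: nat
  assume n: "0 < n"
  have "indet_q ^ n = Fract ([:0, 1:] ^ n) 1"
    by (induction n) (simp_all add: indet_q_def One_fract_def)
  moreover have "[:0, 1:] ^ n \<noteq> (1 :: rat poly poly)"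
  proof
    assume "[:0, 1:] ^ n = (1 :: rat poly poly)"
    \<comment> \<open>Evaluation at q = 0 separates q^n from 1.\<close>
    then have "poly ([:0, 1:] ^ n) 0 = (1 :: rat poly)" by simp
    then show False using n by (simp add: poly_power power_0_left)
  qed
  ultimately show "indet_q ^ n \<noteq> (1 :: rat_fun_aq)"
    by (simp add: One_fract_def eq_fract)
qed

theorem theorem3:
  fixes n1 n2 n3 :: nat
  assumes "n3 \<ge> n1" and "n1 \<ge> n2"
  shows
    "let a = indet_a; q = indet_q;
         C = q_charlier a q;
         K = (\<lambda>l j. int ((l - j) choose 2) + int (n1 choose 2) + int j * (- int n3 - int j + 1)
                + int (j choose 2) + int ((n2 + j - l) choose 2)
                + int ((n3 + j - n1) * (n3 + l - n2)) + int (j * (n3 + l - n2)))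
     in q_charlier_functional a q (C n1 * C n2 * C n3) =
        (\<Sum>l | n3 + l \<le> n1 + n2. \<Sum>j = 0..l.
           a ^ (n3 + l) * q powi K l j * (q - 1) ^ (l - j)
           * (q_fact q (n1 - j) / q_fact q (n1 - l))
           * q_binomial q n2 (l - j) * q_fact q n3 * q_binomial q n1 j
           * q_binomial q (n2 + j - l) (n3 + j - n1)
           * (q_fact q j * q_fact q (n1 - j) / q_fact q (n3 + l - n2))
           * q_binomial q (n1 + n2 - n3 - l) j)"
proof -
  have "is_q_charlier_functional indet_a indet_q (q_charlier_functional indet_a indet_q)"
    unfolding q_charlier_functional_def by (rule theI'[OF q_charlier_functional_ex1])
  then interpret q_charlier_moments indet_q indet_a "q_charlier_functional indet_a indet_q"
    by (intro q_charlier_moments.intro q_charlier_moments_axioms.intro q_nonroot_indet_q)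
  show ?thesis
    unfolding Let_def using assms by (rule L_C_mult_C_mult_C_explicit)
qed

end
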